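(* For the estimators $\widehat\sigma_\varepsilon,\widehat\nu$ defined in the context, the scaled expected length of $K(\widehat\sigma_\varepsilon,\widehat\nu)$, conditional on $x$ (defined as the expected length of $K(\widehat\sigma_\varepsilon,\widehat\nu)$ divided by the expected length of $J_{c^*}(\widehat\sigma_\varepsilon)$, conditional on $x$), is determined by $x$ (the time-varying covariate), $\alpha_H$ (the nominal significance level of the Hausman pretest), $1-\alpha$ (the nominal coverage probability of $K(\widehat\sigma_\varepsilon,\widehat\nu)$), $1-\overline\alpha$ (the coverage probability of the confidence interval for $\nu$), $\nu$ (the ratio $\sigma_\eta^2/\sigma_\varepsilon^2$) and $\gamma=\xi N^{1/2}/\sigma_\varepsilon$ (the scaled non-exogeneity parameter). Given these quantities, the conditional scaled expected length does not depend on $\sigma_\varepsilon^2$ (the variance of the random error) or $\sigma_\eta^2$ (the variance of the random effect).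
   Context: Model. Let $x=(x_{11},\dots,x_{1T},\dots,x_{N1},\dots,x_{NT})$ be the observed values of a time-varying covariate; the analysis is conditional on $x$, so $x$ is treated as given. For $i=1,\dots,N$, $t=1,\dots,T$, $$y_{it}=a+b\,x_{it}+\xi\,\overline{x}_i+\eta_i+\varepsilon_{it},\qquad \overline{x}_i=T^{-1}\sum_{t=1}^T x_{it},$$ where the $\eta_i$'s and $\varepsilon_{it}$'s are unobserved and independent, the $\eta_i$'s are iid $N(0,\sigma_\eta^2)$ and the $\varepsilon_{it}$'s are iid $N(0,\sigma_\varepsilon^2)$. Put $\nu=\sigma_\eta^2/\sigma_\varepsilon^2\in(0,\infty)$ and $\gamma=\xi N^{1/2}/\sigma_\varepsilon\in\mathbb{R}$. Overbars with index $i$ denote averages over $t$ (e.g. $\overline{y}_i$), and overbars without index denote averages of these over $i$ (e.g. $\overline{x}=N^{-1}\sum_i\overline{x}_i$). Let $SSB=\sum_{i}(\overline{x}_i-\overline{x})^2$, $SSW=\sum_{i}\sum_{t}(x_{it}-\overline{x}_i)^2$, $r(x)=SSB/SSW$, and $q(n,T)=n+T^{-1}$. Estimators of slopes. $\widetilde b_W=\sum_i\sum_t(x_{it}-\overline{x}_i)(y_{it}-\overline{y}_i)/SSW$ and $\widetilde b_B=\sum_i(\overline{x}_i-\overline{x})(\overline{y}_i-\overline{y})/SSB$, with $\mathrm{Var}(\widetilde b_W\mid x)=\sigma_\varepsilon^2/SSW$ and $\mathrm{Var}(\widetilde b_B\mid x)=\sigma_\varepsilon^2 q(\nu,T)/SSB$.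 The estimator $\widehat b$ is the GLS estimator of $b$ in the model with $\xi=0$; explicitly $\widehat b=w\widetilde b_W+(1-w)\widetilde b_B$ with $w=q(\nu,T)/(q(\nu,T)+r(x))$, and $\mathrm{Var}(\widehat b\mid x)=\sigma_\varepsilon^2 w/SSW$. Estimators of variances. With $r_{it}=(y_{it}-\overline{y}_i)-\widetilde b_W(x_{it}-\overline{x}_i)$, $\widehat\sigma_\varepsilon^2=\frac{1}{N(T-1)}\sum_i\sum_t r_{it}^2$. With $\widetilde a=\overline{y}-\widetilde b_B\overline{x}$ and $\widetilde r_i=\overline{y}_i-(\widetilde a+\widetilde b_B\overline{x}_i)$, $\widehat\sigma_\eta^2=N^{-1}\sum_i\widetilde r_i^2-T^{-1}\widehat\sigma_\varepsilon^2$. Finally $\widehat\nu=\widehat\sigma_\eta^2/\widehat\sigma_\varepsilon^2$. Two-stage interval. Let $1-\alpha$ be the nominal coverage probability, $\alpha_H$ the nominal significance level of the Hausman pretest, and $z_c=\Phi^{-1}(c)$, with $\Phi$ the $N(0,1)$ cdf. Define $I(\sigma_\varepsilon,\nu)=[\widehat b\pm z_{1-\alpha/2}\mathrm{Var}(\widehat b\mid x)^{1/2}]$, $J(\sigma_\varepsilon)=[\widetilde b_W\pm z_{1-\alpha/2}\mathrm{Var}(\widetilde b_W\mid x)^{1/2}]$ and the Hausman statistic $H(\sigma_\varepsilon,\nu)=(\widetilde b_W-\widetilde b_B)^2/(\mathrm{Var}(\widetilde b_W\mid x)+\mathrm{Var}(\widetilde b_B\mid x))$. $K(\sigma_\varepsilon,\nu)$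 equals $I(\sigma_\varepsilon,\nu)$ if $H(\sigma_\varepsilon,\nu)\le z_{1-\alpha_H/2}^2$ and equals $J(\sigma_\varepsilon)$ otherwise. For $c\in[1/2,1)$ let $J_c(\sigma_\varepsilon)=[\widetilde b_W\pm\Phi^{-1}((c+1)/2)\mathrm{Var}(\widetilde b_W\mid x)^{1/2}]$. $I(\widehat\sigma_\varepsilon,\widehat\nu)$, $J(\widehat\sigma_\varepsilon)$, $J_c(\widehat\sigma_\varepsilon)$, $H(\widehat\sigma_\varepsilon,\widehat\nu)$, $K(\widehat\sigma_\varepsilon,\widehat\nu)$ are obtained by replacing $\sigma_\varepsilon,\nu$ everywhere in these definitions (including in the weight $w$ in $\widehat b$ and in the variance formulas) by $\widehat\sigma_\varepsilon,\widehat\nu$. Definition of $c^*$. For given $x,\alpha,\alpha_H$, the conditional coverage probability $P(b\in K(\widehat\sigma_\varepsilon,\widehat\nu)\mid x)$ is a function of $(\gamma,\nu)$ and is denoted $CP(\gamma,\nu)$; for any given $c$, the coverage probability $P(b\in J_c(\widehat\sigma_\varepsilon))$ does not depend on any unknown parameters. Let $[\nu_\ell,\nu_u]$ be the equi-tailed confidence interval for $\nu$ with coverage probability $1-\overline\alpha$ given by $\big[(\widehat\nu+T^{-1})/F_{1-\overline\alpha/2}-T^{-1},\,(\widehat\nu+T^{-1})/F_{\overline\alpha/2}-T^{-1}\big]$, where $F_p$ is the $p$-quantile of the distribution, conditional on $x$, of the pivotal quantity $(\widehat\nu+T^{-1})/(\nu+T^{-1})$. Then $c^*$ is defined to be the value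 of $c$ such that $P(b\in J_c(\widehat\sigma_\varepsilon))=\min_{n\in[\nu_\ell,\nu_u]}\min_{g}CP(g,n)$, where $g$ ranges over $\mathbb{R}$.
   Formalization: In the definition of c*, negative limits of the confidence interval for ν (where CP is undefined) are replaced by 0, with ν=0 meaning no random effect; minima are read as infima; and c is sought in [0,1) instead of [1/2,1), so that c* always exists. *)

theory Defs
  imports "HOL-Probability.Probability"
begin

section \<open>Panel statistics\<close>

text \<open>
  A panel variable is a function \<open>z i t\<close> with individuals \<open>i < N\<close> and times \<open>t < T\<close>;
  values outside this range are never used.
\<close>

definition group_mean :: "nat \<Rightarrow> (nat \<Rightarrow> nat \<Rightarrow> real) \<Rightarrow> nat \<Rightarrow> real" where
  "group_mean T z i = (\<Sum>t<T. z i t) / real T"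

definition grand_mean :: "nat \<Rightarrow> nat \<Rightarrow> (nat \<Rightarrow> nat \<Rightarrow> real) \<Rightarrow> real" where
  "grand_mean N T z = (\<Sum>i<N. group_mean T z i) / real N"

definition SSB :: "nat \<Rightarrow> nat \<Rightarrow> (nat \<Rightarrow> nat \<Rightarrow> real) \<Rightarrow> real" where
  "SSB N T x = (\<Sum>i<N. (group_mean T x i - grand_mean N T x)\<^sup>2)"

definition SSW :: "nat \<Rightarrow> nat \<Rightarrow> (nat \<Rightarrow> nat \<Rightarrow> real) \<Rightarrow> real" where
  "SSW N T x = (\<Sum>i<N. \<Sum>t<T. (x i t - group_mean T x i)\<^sup>2)"

definition r_ratio :: "nat \<Rightarrow> nat \<Rightarrow> (nat \<Rightarrow> nat \<Rightarrow> real) \<Rightarrow> real" where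
  "r_ratio N T x = SSB N T x / SSW N T x"

definition q_fun :: "real \<Rightarrow> nat \<Rightarrow> real" where
  "q_fun n T = n + 1 / real T"

definition b_within :: "nat \<Rightarrow> nat \<Rightarrow> (nat \<Rightarrow> nat \<Rightarrow> real) \<Rightarrow> (nat \<Rightarrow> nat \<Rightarrow> real) \<Rightarrow> real" where
  "b_within N T x y =
     (\<Sum>i<N. \<Sum>t<T. (x i t - group_mean T x i) * (y i t - group_mean T y i)) / SSW N T x"

definition b_between :: "nat \<Rightarrow> nat \<Rightarrow> (nat \<Rightarrow> nat \<Rightarrow> real) \<Rightarrow> (nat \<Rightarrow> nat \<Rightarrow> real) \<Rightarrow> real" where
  "b_between N T x y =
     (\<Sum>i<N. (group_mean T x i - grand_mean N T x) * (group_mean T y i - grand_mean N T y))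
       / SSB N T x"

definition gls_weight :: "nat \<Rightarrow> nat \<Rightarrow> (nat \<Rightarrow> nat \<Rightarrow> real) \<Rightarrow> real \<Rightarrow> real" where
  "gls_weight N T x n = q_fun n T / (q_fun n T + r_ratio N T x)"

definition b_gls :: "nat \<Rightarrow> nat \<Rightarrow> (nat \<Rightarrow> nat \<Rightarrow> real) \<Rightarrow> real \<Rightarrow> (nat \<Rightarrow> nat \<Rightarrow> real) \<Rightarrow> real" where
  "b_gls N T x n y =
     gls_weight N T x n * b_within N T x y + (1 - gls_weight N T x n) * b_between N T x y"

text \<open>
  Conditional variances of the slope estimators, as functions of the standard deviation \<open>s\<close> of
  the random error and the variance ratio \<open>n\<close>, so that estimates can be substituted for both.
\<close>

definition var_within :: "nat \<Rightarrow> nat \<Rightarrow> (nat \<Rightarrow> nat \<Rightarrow> real) \<Rightarrow> real \<Rightarrow> real" where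
  "var_within N T x s = s\<^sup>2 / SSW N T x"

definition var_between :: "nat \<Rightarrow> nat \<Rightarrow> (nat \<Rightarrow> nat \<Rightarrow> real) \<Rightarrow> real \<Rightarrow> real \<Rightarrow> real" where
  "var_between N T x s n = s\<^sup>2 * q_fun n T / SSB N T x"

definition var_gls :: "nat \<Rightarrow> nat \<Rightarrow> (nat \<Rightarrow> nat \<Rightarrow> real) \<Rightarrow> real \<Rightarrow> real \<Rightarrow> real" where
  "var_gls N T x s n = s\<^sup>2 * gls_weight N T x n / SSW N T x"

definition sigma_eps2_hat ::
    "nat \<Rightarrow> nat \<Rightarrow> (nat \<Rightarrow> nat \<Rightarrow> real) \<Rightarrow> (nat \<Rightarrow> nat \<Rightarrow> real) \<Rightarrow> real" where
  "sigma_eps2_hat N T x y =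
     (\<Sum>i<N. \<Sum>t<T. ((y i t - group_mean T y i)
                       - b_within N T x y * (x i t - group_mean T x i))\<^sup>2)
       / (real N * (real T - 1))"

definition sigma_eps_hat ::
    "nat \<Rightarrow> nat \<Rightarrow> (nat \<Rightarrow> nat \<Rightarrow> real) \<Rightarrow> (nat \<Rightarrow> nat \<Rightarrow> real) \<Rightarrow> real" where
  "sigma_eps_hat N T x y = sqrt (sigma_eps2_hat N T x y)"

definition a_between :: "nat \<Rightarrow> nat \<Rightarrow> (nat \<Rightarrow> nat \<Rightarrow> real) \<Rightarrow> (nat \<Rightarrow> nat \<Rightarrow> real) \<Rightarrow> real" where
  "a_between N T x y = grand_mean N T y - b_between N T x y * grand_mean N T x"

definition sigma_eta2_hat ::
    "nat \<Rightarrow> nat \<Rightarrow> (nat \<Rightarrow> nat \<Rightarrow> real) \<Rightarrow> (nat \<Rightarrow> nat \<Rightarrow> real) \<Rightarrow> real" where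
  "sigma_eta2_hat N T x y =
     (\<Sum>i<N. (group_mean T y i - (a_between N T x y + b_between N T x y * group_mean T x i))\<^sup>2)
       / real N - sigma_eps2_hat N T x y / real T"

definition nu_hat :: "nat \<Rightarrow> nat \<Rightarrow> (nat \<Rightarrow> nat \<Rightarrow> real) \<Rightarrow> (nat \<Rightarrow> nat \<Rightarrow> real) \<Rightarrow> real" where
  "nu_hat N T x y = sigma_eta2_hat N T x y / sigma_eps2_hat N T x y"

section \<open>Confidence intervals\<close>

definition std_normal_quantile :: "real \<Rightarrow> real" where
  "std_normal_quantile = inv (cdf std_normal_distribution)"

definition interval_I ::
    "nat \<Rightarrow> nat \<Rightarrow> (nat \<Rightarrow> nat \<Rightarrow> real) \<Rightarrow> real \<Rightarrow> real \<Rightarrow> real \<Rightarrow> (nat \<Rightarrow> nat \<Rightarrow> real) \<Rightarrow> real set" where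
  "interval_I N T x \<alpha> s n y =
     (let h = std_normal_quantile (1 - \<alpha> / 2) * sqrt (var_gls N T x s n)
      in {b_gls N T x n y - h .. b_gls N T x n y + h})"

definition interval_J ::
    "nat \<Rightarrow> nat \<Rightarrow> (nat \<Rightarrow> nat \<Rightarrow> real) \<Rightarrow> real \<Rightarrow> real \<Rightarrow> (nat \<Rightarrow> nat \<Rightarrow> real) \<Rightarrow> real set" where
  "interval_J N T x \<alpha> s y =
     (let h = std_normal_quantile (1 - \<alpha> / 2) * sqrt (var_within N T x s)
      in {b_within N T x y - h .. b_within N T x y + h})"

definition interval_Jc ::
    "nat \<Rightarrow> nat \<Rightarrow> (nat \<Rightarrow> nat \<Rightarrow> real) \<Rightarrow> real \<Rightarrow> real \<Rightarrow> (nat \<Rightarrow> nat \<Rightarrow> real) \<Rightarrow> real set" where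
  "interval_Jc N T x c s y =
     (let h = std_normal_quantile ((c + 1) / 2) * sqrt (var_within N T x s)
      in {b_within N T x y - h .. b_within N T x y + h})"

definition hausman ::
    "nat \<Rightarrow> nat \<Rightarrow> (nat \<Rightarrow> nat \<Rightarrow> real) \<Rightarrow> real \<Rightarrow> real \<Rightarrow> (nat \<Rightarrow> nat \<Rightarrow> real) \<Rightarrow> real" where
  "hausman N T x s n y =
     (b_within N T x y - b_between N T x y)\<^sup>2 / (var_within N T x s + var_between N T x s n)"

definition interval_K ::
    "nat \<Rightarrow> nat \<Rightarrow> (nat \<Rightarrow> nat \<Rightarrow> real) \<Rightarrow> real \<Rightarrow> real \<Rightarrow> real \<Rightarrow> real \<Rightarrow> (nat \<Rightarrow> nat \<Rightarrow> real) \<Rightarrow> real set"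
  where
  "interval_K N T x \<alpha>\<^sub>H \<alpha> s n y =
     (if hausman N T x s n y \<le> (std_normal_quantile (1 - \<alpha>\<^sub>H / 2))\<^sup>2
      then interval_I N T x \<alpha> s n y
      else interval_J N T x \<alpha> s y)"

definition K_hat ::
    "nat \<Rightarrow> nat \<Rightarrow> (nat \<Rightarrow> nat \<Rightarrow> real) \<Rightarrow> real \<Rightarrow> real \<Rightarrow> (nat \<Rightarrow> nat \<Rightarrow> real) \<Rightarrow> real set" where
  "K_hat N T x \<alpha>\<^sub>H \<alpha> y = interval_K N T x \<alpha>\<^sub>H \<alpha> (sigma_eps_hat N T x y) (nu_hat N T x y) y"

definition Jc_hat ::
    "nat \<Rightarrow> nat \<Rightarrow> (nat \<Rightarrow> nat \<Rightarrow> real) \<Rightarrow> real \<Rightarrow> (nat \<Rightarrow> nat \<Rightarrow> real) \<Rightarrow> real set" where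
  "Jc_hat N T x c y = interval_Jc N T x c (sigma_eps_hat N T x y) y"

section \<open>The model\<close>

text \<open>
  The normal distribution with mean 0 and standard deviation \<open>\<sigma>\<close>.  The degenerate case
  \<open>\<sigma> = 0\<close> has to be treated separately because \<open>normal_density 0 0\<close> is not a
  probability density.
\<close>

definition centered_normal :: "real \<Rightarrow> real measure" where
  "centered_normal \<sigma> =
     (if \<sigma> = 0 then return borel 0 else density lborel (\<lambda>z. ennreal (normal_density 0 \<sigma> z)))"

text \<open>
  Joint distribution of the unobserved variables: the coordinate \<open>Inl i\<close> is the random effect of
  individual \<open>i\<close>, the coordinate \<open>Inr (i, t)\<close> the random error of individual \<open>i\<close> at time
  \<open>t\<close>, all independent.  The covariate \<open>x\<close> is a constant throughout, so probabilities and
  expectations under this measure are those conditional on \<open>x\<close>.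
\<close>

definition noise :: "nat \<Rightarrow> nat \<Rightarrow> real \<Rightarrow> real \<Rightarrow> (nat + nat \<times> nat \<Rightarrow> real) measure" where
  "noise N T \<sigma>\<^sub>\<eta> \<sigma>\<^sub>\<epsilon> =
     (\<Pi>\<^sub>M k \<in> {..<N} <+> ({..<N} \<times> {..<T}).
        case k of Inl i \<Rightarrow> centered_normal \<sigma>\<^sub>\<eta> | Inr p \<Rightarrow> centered_normal \<sigma>\<^sub>\<epsilon>)"

definition response ::
    "nat \<Rightarrow> (nat \<Rightarrow> nat \<Rightarrow> real) \<Rightarrow> real \<Rightarrow> real \<Rightarrow> real \<Rightarrow> (nat + nat \<times> nat \<Rightarrow> real)
       \<Rightarrow> nat \<Rightarrow> nat \<Rightarrow> real" where
  "response T x a b \<xi> \<omega> i t =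
     a + b * x i t + \<xi> * group_mean T x i + \<omega> (Inl i) + \<omega> (Inr (i, t))"

section \<open>Coverage probabilities\<close>

definition coverage_K ::
    "nat \<Rightarrow> nat \<Rightarrow> (nat \<Rightarrow> nat \<Rightarrow> real) \<Rightarrow> real \<Rightarrow> real
       \<Rightarrow> real \<Rightarrow> real \<Rightarrow> real \<Rightarrow> real \<Rightarrow> real \<Rightarrow> real" where
  "coverage_K N T x \<alpha>\<^sub>H \<alpha> a b \<xi> \<sigma>\<^sub>\<eta> \<sigma>\<^sub>\<epsilon> =
     measure (noise N T \<sigma>\<^sub>\<eta> \<sigma>\<^sub>\<epsilon>)
       {\<omega> \<in> space (noise N T \<sigma>\<^sub>\<eta> \<sigma>\<^sub>\<epsilon>). b \<in> K_hat N T x \<alpha>\<^sub>H \<alpha> (response T x a b \<xi> \<omega>)}"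

definition coverage_Jc ::
    "nat \<Rightarrow> nat \<Rightarrow> (nat \<Rightarrow> nat \<Rightarrow> real) \<Rightarrow> real
       \<Rightarrow> real \<Rightarrow> real \<Rightarrow> real \<Rightarrow> real \<Rightarrow> real \<Rightarrow> real" where
  "coverage_Jc N T x c a b \<xi> \<sigma>\<^sub>\<eta> \<sigma>\<^sub>\<epsilon> =
     measure (noise N T \<sigma>\<^sub>\<eta> \<sigma>\<^sub>\<epsilon>)
       {\<omega> \<in> space (noise N T \<sigma>\<^sub>\<eta> \<sigma>\<^sub>\<epsilon>). b \<in> Jc_hat N T x c (response T x a b \<xi> \<omega>)}"

text \<open>
  The coverage probability of the two-stage interval is a function of the scaled non-exogeneity
  parameter and the variance ratio only: \<open>CP g n\<close> is its common value over all parameter values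
  with \<open>\<gamma> = g\<close> and \<open>\<nu> = n\<close>.  The boundary value \<open>n = 0\<close> (no random effect) is
  included for \<open>min_coverage\<close> below.
\<close>

definition CP ::
    "nat \<Rightarrow> nat \<Rightarrow> (nat \<Rightarrow> nat \<Rightarrow> real) \<Rightarrow> real \<Rightarrow> real \<Rightarrow> real \<Rightarrow> real \<Rightarrow> real" where
  "CP N T x \<alpha>\<^sub>H \<alpha> g n =
     (THE p. \<forall>a b \<xi> \<sigma>\<^sub>\<eta> \<sigma>\<^sub>\<epsilon>. \<sigma>\<^sub>\<eta> \<ge> 0 \<and> \<sigma>\<^sub>\<epsilon> > 0 \<and>
        \<xi> * sqrt (real N) / \<sigma>\<^sub>\<epsilon> = g \<and> \<sigma>\<^sub>\<eta>\<^sup>2 / \<sigma>\<^sub>\<epsilon>\<^sup>2 = n \<longrightarrow>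
          coverage_K N T x \<alpha>\<^sub>H \<alpha> a b \<xi> \<sigma>\<^sub>\<eta> \<sigma>\<^sub>\<epsilon> = p)"

text \<open>The coverage probability of \<open>Jc_hat\<close> does not depend on any unknown parameter.\<close>

definition CP_Jc :: "nat \<Rightarrow> nat \<Rightarrow> (nat \<Rightarrow> nat \<Rightarrow> real) \<Rightarrow> real \<Rightarrow> real" where
  "CP_Jc N T x c =
     (THE p. \<forall>a b \<xi> \<sigma>\<^sub>\<eta> \<sigma>\<^sub>\<epsilon>. \<sigma>\<^sub>\<eta> > 0 \<and> \<sigma>\<^sub>\<epsilon> > 0 \<longrightarrow>
        coverage_Jc N T x c a b \<xi> \<sigma>\<^sub>\<eta> \<sigma>\<^sub>\<epsilon> = p)"

section \<open>Confidence interval for the variance ratio\<close>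

definition quantile :: "real measure \<Rightarrow> real \<Rightarrow> real" where
  "quantile M p = Inf {v. p \<le> cdf M v}"

definition pivot_distr ::
    "nat \<Rightarrow> nat \<Rightarrow> (nat \<Rightarrow> nat \<Rightarrow> real) \<Rightarrow> real \<Rightarrow> real \<Rightarrow> real \<Rightarrow> real \<Rightarrow> real \<Rightarrow> real measure" where
  "pivot_distr N T x a b \<xi> \<sigma>\<^sub>\<eta> \<sigma>\<^sub>\<epsilon> =
     distr (noise N T \<sigma>\<^sub>\<eta> \<sigma>\<^sub>\<epsilon>) borel
       (\<lambda>\<omega>. (nu_hat N T x (response T x a b \<xi> \<omega>) + 1 / real T)
              / (\<sigma>\<^sub>\<eta>\<^sup>2 / \<sigma>\<^sub>\<epsilon>\<^sup>2 + 1 / real T))"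

text \<open>\<open>F_quantile\<close> is well defined because \<open>pivot_distr\<close> is the same for all parameters.\<close>

definition F_quantile :: "nat \<Rightarrow> nat \<Rightarrow> (nat \<Rightarrow> nat \<Rightarrow> real) \<Rightarrow> real \<Rightarrow> real" where
  "F_quantile N T x p =
     (THE v. \<forall>a b \<xi> \<sigma>\<^sub>\<eta> \<sigma>\<^sub>\<epsilon>. \<sigma>\<^sub>\<eta> > 0 \<and> \<sigma>\<^sub>\<epsilon> > 0 \<longrightarrow>
        quantile (pivot_distr N T x a b \<xi> \<sigma>\<^sub>\<eta> \<sigma>\<^sub>\<epsilon>) p = v)"

text \<open>The confidence limits and \<open>c_star\<close> depend on the data only through \<open>v = nu_hat\<close>.\<close>

definition nu_lower :: "nat \<Rightarrow> nat \<Rightarrow> (nat \<Rightarrow> nat \<Rightarrow> real) \<Rightarrow> real \<Rightarrow> real \<Rightarrow> real" where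
  "nu_lower N T x \<beta> v = (v + 1 / real T) / F_quantile N T x (1 - \<beta> / 2) - 1 / real T"

definition nu_upper :: "nat \<Rightarrow> nat \<Rightarrow> (nat \<Rightarrow> nat \<Rightarrow> real) \<Rightarrow> real \<Rightarrow> real \<Rightarrow> real" where
  "nu_upper N T x \<beta> v = (v + 1 / real T) / F_quantile N T x (\<beta> / 2) - 1 / real T"

section \<open>Scaled expected length\<close>

text \<open>
  Two conventions make the following total without changing it where the limits are nonnegative
  and the solution \<open>c\<close> lies in \<open>[1/2, 1)\<close>.  A negative confidence limit for \<open>\<nu>\<close>
  (\<open>nu_hat\<close> may be negative) is replaced by 0, since there is no model with a negative variance
  ratio.  The solution is sought in \<open>[0, 1)\<close>, where it always exists and is unique, because the
  minimal coverage may be too small for a solution in \<open>[1/2, 1)\<close>.  Minima are infima because the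
  one over \<open>g\<close> need not be attained.
\<close>

definition min_coverage ::
    "nat \<Rightarrow> nat \<Rightarrow> (nat \<Rightarrow> nat \<Rightarrow> real) \<Rightarrow> real \<Rightarrow> real \<Rightarrow> real \<Rightarrow> real \<Rightarrow> real" where
  "min_coverage N T x \<alpha>\<^sub>H \<alpha> \<beta> v =
     (INF n \<in> {max 0 (nu_lower N T x \<beta> v) .. max 0 (nu_upper N T x \<beta> v)}.
        INF g \<in> (UNIV :: real set). CP N T x \<alpha>\<^sub>H \<alpha> g n)"

definition c_star ::
    "nat \<Rightarrow> nat \<Rightarrow> (nat \<Rightarrow> nat \<Rightarrow> real) \<Rightarrow> real \<Rightarrow> real \<Rightarrow> real \<Rightarrow> real \<Rightarrow> real" where
  "c_star N T x \<alpha>\<^sub>H \<alpha> \<beta> v =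
     (THE c. 0 \<le> c \<and> c < 1 \<and> CP_Jc N T x c = min_coverage N T x \<alpha>\<^sub>H \<alpha> \<beta> v)"

definition J_star_hat ::
    "nat \<Rightarrow> nat \<Rightarrow> (nat \<Rightarrow> nat \<Rightarrow> real) \<Rightarrow> real \<Rightarrow> real \<Rightarrow> real \<Rightarrow> (nat \<Rightarrow> nat \<Rightarrow> real) \<Rightarrow> real set"
  where
  "J_star_hat N T x \<alpha>\<^sub>H \<alpha> \<beta> y = Jc_hat N T x (c_star N T x \<alpha>\<^sub>H \<alpha> \<beta> (nu_hat N T x y)) y"

definition scaled_expected_length ::
    "nat \<Rightarrow> nat \<Rightarrow> (nat \<Rightarrow> nat \<Rightarrow> real) \<Rightarrow> real \<Rightarrow> real \<Rightarrow> real
       \<Rightarrow> real \<Rightarrow> real \<Rightarrow> real \<Rightarrow> real \<Rightarrow> real \<Rightarrow> real" where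
  "scaled_expected_length N T x \<alpha>\<^sub>H \<alpha> \<beta> a b \<xi> \<sigma>\<^sub>\<eta> \<sigma>\<^sub>\<epsilon> =
     (\<integral>\<omega>. measure lborel (K_hat N T x \<alpha>\<^sub>H \<alpha> (response T x a b \<xi> \<omega>)) \<partial>noise N T \<sigma>\<^sub>\<eta> \<sigma>\<^sub>\<epsilon>)
     / (\<integral>\<omega>. measure lborel (J_star_hat N T x \<alpha>\<^sub>H \<alpha> \<beta> (response T x a b \<xi> \<omega>)) \<partial>noise N T \<sigma>\<^sub>\<eta> \<sigma>\<^sub>\<epsilon>)"

end

theory Submission
  imports Defs
begin

text \<open>
  Dividing the noise by \<open>\<sigma>\<^sub>\<epsilon>\<close> writes the response as \<open>y = a + b x + \<sigma>\<^sub>\<epsilon> z\<close>, where the law of \<open>z\<close>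
  depends on the parameters only through \<open>\<nu>\<close> and \<open>\<gamma>\<close>.  Under this change of data
  \<open>nu_hat\<close> and the Hausman statistic are invariant and all standard errors are multiplied by
  \<open>\<sigma>\<^sub>\<epsilon>\<close>.  Hence \<open>c_star\<close> and the decision of the pretest are the same for \<open>y\<close> and \<open>z\<close>, and the
  factor \<open>\<sigma>\<^sub>\<epsilon>\<close> cancels in the ratio of the expected lengths.
\<close>

section \<open>Equivariance of the panel statistics\<close>

text \<open>The relation is required only inside the panel: rescaled noise is
  \<open>undefined\<close> off its index set, so it need not extend. Here \<open>b\<close> is the
  true slope and \<open>s\<close> becomes the error standard deviation.\<close>

locale affine_panel =
  fixes N T :: nat and x y z :: "nat \<Rightarrow> nat \<Rightarrow> real" and a b s :: real
  assumes SSB_pos: "SSB N T x > 0" and SSW_pos: "SSW N T x > 0" and s_pos: "s > 0"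
    and affine: "\<And>i t. i < N \<Longrightarrow> t < T \<Longrightarrow> y i t = a + b * x i t + s * z i t"
begin

lemma N_pos: "N > 0"
  using SSB_pos by (cases N) (auto simp: SSB_def)

lemma T_pos: "T > 0"
  using SSW_pos by (cases T) (auto simp: SSW_def)

lemma group_mean_affine:
  assumes "i < N"
  shows "group_mean T y i = a + b * group_mean T x i + s * group_mean T z i"
proof -
  have "(\<Sum>t<T. y i t) = (\<Sum>t<T. a + b * x i t + s * z i t)"
    using assms by (intro sum.cong) (auto simp: affine)
  also have "\<dots> = real T * a + b * (\<Sum>t<T. x i t) + s * (\<Sum>t<T. z i t)"
    by (simp add: sum.distrib sum_distrib_left)
  finally show ?thesis
    using T_pos by (simp add: group_mean_def add_divide_distrib)
qed

lemma grand_mean_affine: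
  "grand_mean N T y = a + b * grand_mean N T x + s * grand_mean N T z"
proof -
  have "(\<Sum>i<N. group_mean T y i) =
      (\<Sum>i<N. a + b * group_mean T x i + s * group_mean T z i)"
    by (intro sum.cong) (auto simp: group_mean_affine)
  also have "\<dots> = real N * a + b * (\<Sum>i<N. group_mean T x i) + s * (\<Sum>i<N. group_mean T z i)"
    by (simp add: sum.distrib sum_distrib_left)
  finally show ?thesis
    using N_pos by (simp add: grand_mean_def add_divide_distrib)
qed

lemma within_deviation_affine:
  assumes "i < N" "t < T"
  shows "y i t - group_mean T y i =
    b * (x i t - group_mean T x i) + s * (z i t - group_mean T z i)"
  using assms by (simp add: affine group_mean_affine algebra_simps)

lemma between_deviation_affine:
  assumes "i < N"
  shows "group_mean T y i - grand_mean N T y =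
    b * (group_mean T x i - grand_mean N T x) + s * (group_mean T z i - grand_mean N T z)"
  using assms by (simp add: group_mean_affine grand_mean_affine algebra_simps)

text \<open>Centering removes \<open>a\<close>, and regressing \<open>x\<close> on itself gives
  slope 1 because \<open>SSW\<close> is nonzero; the rest is linearity.\<close>

lemma b_within_affine: "b_within N T x y = b + s * b_within N T x z"
proof -
  let ?d = "\<lambda>w i t. w i t - group_mean T w i"
  have "(\<Sum>i<N. \<Sum>t<T. ?d x i t * ?d y i t) =
      (\<Sum>i<N. \<Sum>t<T. b * (?d x i t)\<^sup>2 + s * (?d x i t * ?d z i t))"
    by (intro sum.cong refl)
      (simp add: within_deviation_affine power2_eq_square algebra_simps)
  also have "\<dots> = b * SSW N T x + s * (\<Sum>i<N. \<Sum>t<T. ?d x i t * ?d z i t)"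
    by (simp only: SSW_def sum.distrib sum_distrib_left)
  finally show ?thesis
    using SSW_pos by (simp add: b_within_def add_divide_distrib)
qed

lemma b_between_affine: "b_between N T x y = b + s * b_between N T x z"
proof -
  let ?d = "\<lambda>w i. group_mean T w i - grand_mean N T w"
  have "(\<Sum>i<N. ?d x i * ?d y i) = (\<Sum>i<N. b * (?d x i)\<^sup>2 + s * (?d x i * ?d z i))"
    by (intro sum.cong refl)
      (simp add: between_deviation_affine power2_eq_square algebra_simps)
  also have "\<dots> = b * SSB N T x + s * (\<Sum>i<N. ?d x i * ?d z i)"
    by (simp only: SSB_def sum.distrib sum_distrib_left)
  finally show ?thesis
    using SSB_pos by (simp add: b_between_def add_divide_distrib)
qed

text \<open>The shift of the estimated slope by \<open>b\<close> absorbs the \<open>b * x\<close>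
  part of the data, so every residual is just multiplied by \<open>s\<close>.\<close>

lemma sigma_eps2_hat_affine: "sigma_eps2_hat N T x y = s\<^sup>2 * sigma_eps2_hat N T x z"
proof -
  let ?r = "\<lambda>w i t. (w i t - group_mean T w i) - b_within N T x w * (x i t - group_mean T x i)"
  have "?r y i t = s * ?r z i t" if "i < N" "t < T" for i t
    unfolding within_deviation_affine[OF that] b_within_affine by (simp add: algebra_simps)
  then have "(\<Sum>i<N. \<Sum>t<T. (?r y i t)\<^sup>2) = (\<Sum>i<N. \<Sum>t<T. s\<^sup>2 * (?r z i t)\<^sup>2)"
    by (intro sum.cong refl) (simp add: power_mult_distrib)
  then show ?thesis
    by (simp add: sigma_eps2_hat_def sum_distrib_left)
qed

lemma sigma_eps_hat_affine: "sigma_eps_hat N T x y = s * sigma_eps_hat N T x z"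
  using s_pos by (simp add: sigma_eps_hat_def sigma_eps2_hat_affine real_sqrt_mult)

lemma sigma_eta2_hat_affine: "sigma_eta2_hat N T x y = s\<^sup>2 * sigma_eta2_hat N T x z"
proof -
  let ?r = "\<lambda>w i. group_mean T w i - (a_between N T x w + b_between N T x w * group_mean T x i)"
  have "?r y i = s * ?r z i" if "i < N" for i
    unfolding a_between_def group_mean_affine[OF that] grand_mean_affine b_between_affine
    by (simp add: algebra_simps)
  then have "(\<Sum>i<N. (?r y i)\<^sup>2) = (\<Sum>i<N. s\<^sup>2 * (?r z i)\<^sup>2)"
    by (intro sum.cong refl) (simp add: power_mult_distrib)
  also have "\<dots> = s\<^sup>2 * (\<Sum>i<N. (?r z i)\<^sup>2)"
    by (simp only: sum_distrib_left)
  finally show ?thesis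
    by (simp add: sigma_eta2_hat_def sigma_eps2_hat_affine right_diff_distrib)
qed

text \<open>The common factor cancels even if \<open>sigma_eps2_hat\<close> vanishes, where both
  sides are 0 by the convention for division.\<close>

lemma nu_hat_affine: "nu_hat N T x y = nu_hat N T x z"
  using s_pos by (simp add: nu_hat_def sigma_eta2_hat_affine sigma_eps2_hat_affine)

lemma sqrt_var_within_affine: "sqrt (var_within N T x (s * v)) = s * sqrt (var_within N T x v)"
  using s_pos by (simp add: var_within_def power_mult_distrib real_sqrt_mult real_sqrt_divide)

lemma sqrt_var_gls_affine: "sqrt (var_gls N T x (s * v) n) = s * sqrt (var_gls N T x v n)"
  using s_pos by (simp add: var_gls_def power_mult_distrib real_sqrt_mult real_sqrt_divide)

text \<open>The true slope drops out of the difference of the two estimators; numerator and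
  denominator then both carry the square of \<open>s\<close>.\<close>

lemma hausman_affine: "hausman N T x (s * v) n y = hausman N T x v n z"
proof -
  have "(b_within N T x y - b_between N T x y)\<^sup>2 =
      s\<^sup>2 * (b_within N T x z - b_between N T x z)\<^sup>2"
    by (simp add: b_within_affine b_between_affine power_mult_distrib flip: right_diff_distrib)
  moreover have "var_within N T x (s * v) + var_between N T x (s * v) n =
      s\<^sup>2 * (var_within N T x v + var_between N T x v n)"
    by (simp add: var_within_def var_between_def power_mult_distrib distrib_left)
  ultimately show ?thesis
    using s_pos by (simp add: hausman_def)
qed

end

section \<open>Lengths of the intervals\<close>

text \<open>The length forgets the centre, which disposes of the shift by \<open>b\<close>. With
  \<open>max\<close>, the formula covers empty intervals, so the sign of the normal quantile, in
  particular at \<open>c_star\<close>, never has to be determined.\<close>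

lemma measure_symmetric_interval:
  fixes m h :: real
  shows "measure lborel {m - h..m + h} = 2 * max 0 h"
  by (cases "h \<ge> 0") (auto simp: max_def)

context affine_panel
begin

lemma max_zero_scale: "max 0 (s * h) = s * max 0 h"
  using s_pos max_mult_distrib_left[of s 0 h] by simp

text \<open>The pretest threshold is free of data and the statistic is invariant, so
  \<open>y\<close> and \<open>z\<close> select the same branch; in either branch the half-width
  scales by \<open>s\<close>.\<close>

lemma measure_K_hat_affine:
  "measure lborel (K_hat N T x \<alpha>\<^sub>H \<alpha> y) = s * measure lborel (K_hat N T x \<alpha>\<^sub>H \<alpha> z)"
  by (simp only: K_hat_def interval_K_def interval_I_def interval_J_def Let_def
      hausman_affine sigma_eps_hat_affine nu_hat_affine
      sqrt_var_within_affine sqrt_var_gls_affine measure_symmetric_interval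
      max_zero_scale mult.left_commute[of _ s] simp_thms split: if_split cong: imp_cong)

lemma measure_Jc_hat_affine:
  "measure lborel (Jc_hat N T x c y) = s * measure lborel (Jc_hat N T x c z)"
  by (simp only: Jc_hat_def interval_Jc_def Let_def sigma_eps_hat_affine
      sqrt_var_within_affine measure_symmetric_interval max_zero_scale mult.left_commute[of _ s])

text \<open>Since \<open>c_star\<close> sees the data only through \<open>nu_hat\<close>, the same
  \<open>c\<close> occurs on both sides, whatever value its definite description denotes.\<close>

lemma measure_J_star_hat_affine:
  "measure lborel (J_star_hat N T x \<alpha>\<^sub>H \<alpha> \<beta> y) =
    s * measure lborel (J_star_hat N T x \<alpha>\<^sub>H \<alpha> \<beta> z)"
  by (simp add: J_star_hat_def measure_Jc_hat_affine nu_hat_affine)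

end

section \<open>Scaling the noise\<close>

lemma sets_centered_normal [measurable_cong]: "sets (centered_normal \<sigma>) = sets borel"
  by (simp add: centered_normal_def)

lemma prob_space_centered_normal:
  assumes "\<sigma> > 0"
  shows "prob_space (centered_normal \<sigma>)"
  using assms prob_space_normal_density[of \<sigma> 0] by (simp add: centered_normal_def)

lemma distr_centered_normal_scale:
  assumes "\<sigma> > 0" "s > 0"
  shows "distr (centered_normal \<sigma>) (centered_normal (s * \<sigma>)) (\<lambda>z. s * z) = centered_normal (s * \<sigma>)"
proof -
  interpret prob_space "centered_normal \<sigma>"
    by (rule prob_space_centered_normal) fact
  have "distributed (centered_normal \<sigma>) lborel (\<lambda>z. z) (normal_density 0 \<sigma>)"
    using assms by (auto simp: distributed_def centered_normal_def distr_id2)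
  from normal_density_affine[OF this, of s 0]
  have "distributed (centered_normal \<sigma>) lborel (\<lambda>z. s * z) (normal_density 0 (s * \<sigma>))"
    using assms by simp
  then have "distr (centered_normal \<sigma>) lborel (\<lambda>z. s * z) = centered_normal (s * \<sigma>)"
    using assms by (simp add: distributed_def centered_normal_def)
  \<comment> \<open>\<open>distr\<close> uses only the sets of its target, so \<open>lborel\<close>
    may be exchanged for the component measure that \<open>distr_noise_scale\<close>
    expects.\<close>
  moreover have "distr (centered_normal \<sigma>) lborel (\<lambda>z. s * z) =
      distr (centered_normal \<sigma>) (centered_normal (s * \<sigma>)) (\<lambda>z. s * z)"
    by (rule distr_cong) (simp_all add: sets_centered_normal)
  ultimately show ?thesis by simp
qed

abbreviation noise_index :: "nat \<Rightarrow> nat \<Rightarrow> (nat + nat \<times> nat) set" where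
  "noise_index N T \<equiv> {..<N} <+> ({..<N} \<times> {..<T})"

text \<open>All components carry the Borel sets, so the deviations on the two sides are unrelated
  and the inverse scaling is covered too. \<open>compose\<close> restores \<open>undefined\<close>
  off the index set, as the product space demands.\<close>

lemma measurable_noise_scale:
  "compose (noise_index N T) (\<lambda>z. s * z) \<in> noise N T \<sigma>\<^sub>\<eta> \<sigma>\<^sub>\<epsilon> \<rightarrow>\<^sub>M noise N T \<tau>\<^sub>\<eta> \<tau>\<^sub>\<epsilon>"
proof -
  have "(\<lambda>\<omega>. \<lambda>k\<in>noise_index N T. s * \<omega> k) \<in> noise N T \<sigma>\<^sub>\<eta> \<sigma>\<^sub>\<epsilon> \<rightarrow>\<^sub>M noise N T \<tau>\<^sub>\<eta> \<tau>\<^sub>\<epsilon>"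
    unfolding noise_def
  proof (rule measurable_restrict)
    fix k assume k: "k \<in> noise_index N T"
    let ?M = "\<lambda>k. case k of Inl i \<Rightarrow> centered_normal \<sigma>\<^sub>\<eta> | Inr p \<Rightarrow> centered_normal \<sigma>\<^sub>\<epsilon>"
    have "(\<lambda>\<omega>. \<omega> k) \<in> Pi\<^sub>M (noise_index N T) ?M \<rightarrow>\<^sub>M ?M k"
      using k by (rule measurable_component_singleton)
    also have "(Pi\<^sub>M (noise_index N T) ?M \<rightarrow>\<^sub>M ?M k) = (Pi\<^sub>M (noise_index N T) ?M \<rightarrow>\<^sub>M borel)"
      by (intro measurable_cong_sets) (auto simp: sets_centered_normal split: sum.split)
    finally have "(\<lambda>\<omega>. s * \<omega> k) \<in> Pi\<^sub>M (noise_index N T) ?M \<rightarrow>\<^sub>M borel"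
      by (rule borel_measurable_times[OF borel_measurable_const])
    also have "(Pi\<^sub>M (noise_index N T) ?M \<rightarrow>\<^sub>M borel) = (Pi\<^sub>M (noise_index N T) ?M \<rightarrow>\<^sub>M
        (case k of Inl i \<Rightarrow> centered_normal \<tau>\<^sub>\<eta> | Inr p \<Rightarrow> centered_normal \<tau>\<^sub>\<epsilon>))"
      by (intro measurable_cong_sets) (auto simp: sets_centered_normal split: sum.split)
    finally show "(\<lambda>\<omega>. s * \<omega> k) \<in> Pi\<^sub>M (noise_index N T) ?M \<rightarrow>\<^sub>M
        (case k of Inl i \<Rightarrow> centered_normal \<tau>\<^sub>\<eta> | Inr p \<Rightarrow> centered_normal \<tau>\<^sub>\<epsilon>)" .
  qed
  then show ?thesis
    by (simp add: compose_def[abs_def])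
qed

text \<open>The map acts coordinatewise with one factor, so the image of the product law is the
  product of the image laws.\<close>

lemma distr_noise_scale:
  assumes "\<sigma>\<^sub>\<eta> > 0" "\<sigma>\<^sub>\<epsilon> > 0" "s > 0"
  shows "distr (noise N T \<sigma>\<^sub>\<eta> \<sigma>\<^sub>\<epsilon>) (noise N T (s * \<sigma>\<^sub>\<eta>) (s * \<sigma>\<^sub>\<epsilon>))
      (compose (noise_index N T) (\<lambda>z. s * z)) = noise N T (s * \<sigma>\<^sub>\<eta>) (s * \<sigma>\<^sub>\<epsilon>)"
proof -
  have meas: "(\<lambda>z. s * z) \<in> centered_normal \<sigma> \<rightarrow>\<^sub>M centered_normal \<tau>" for \<sigma> \<tau>
    by measurable
  show ?thesis
    unfolding noise_def
    by (subst distr_PiM_finite_prob_space')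
      (auto simp: assms prob_space_centered_normal distr_centered_normal_scale meas
        intro!: PiM_cong split: sum.split)
qed

text \<open>
  No measurability of \<open>f\<close> is assumed: \<open>c_star\<close> as a function of \<open>nu_hat\<close> is not known to be
  measurable.
\<close>

lemma integral_distr_iso:
  fixes f :: "'b \<Rightarrow> real"
  assumes g: "g \<in> M \<rightarrow>\<^sub>M N" and h: "h \<in> N \<rightarrow>\<^sub>M M" and gh: "\<And>u. u \<in> space N \<Longrightarrow> g (h u) = u"
  shows "integral\<^sup>L (distr M N g) f = (\<integral>u. f (g u) \<partial>M)"
proof (cases "f \<in> borel_measurable N")
  case True
  then show ?thesis by (rule integral_distr[OF g])
next
  case False
  \<comment> \<open>The right inverse \<open>h\<close> recovers \<open>f\<close> from its
    composition with \<open>g\<close>, so measurability of the composition would pass to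
    \<open>f\<close>.\<close>
  have "(\<lambda>u. f (g u)) \<notin> borel_measurable M"
  proof
    assume "(\<lambda>u. f (g u)) \<in> borel_measurable M"
    then have "(\<lambda>u. f (g (h u))) \<in> borel_measurable N"
      by (rule measurable_compose[OF h])
    then have "f \<in> borel_measurable N"
      by (subst measurable_cong[where g = "\<lambda>u. f (g (h u))"]) (simp_all add: gh)
    with False show False ..
  qed
  then show ?thesis
    using False
    \<comment> \<open>Neither integrand is measurable, so both integrals have the default value
      0.\<close>
    by (subst (1 2) not_integrable_integral_eq) (auto dest!: borel_measurable_integrable)
qed

lemma integral_noise_scale:
  fixes F :: "(nat + nat \<times> nat \<Rightarrow> real) \<Rightarrow> real"
  assumes "\<sigma>\<^sub>\<eta> > 0" "\<sigma>\<^sub>\<epsilon> > 0" "s > 0"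
  shows "integral\<^sup>L (noise N T (s * \<sigma>\<^sub>\<eta>) (s * \<sigma>\<^sub>\<epsilon>)) F =
    (\<integral>\<omega>. F (compose (noise_index N T) (\<lambda>z. s * z) \<omega>) \<partial>noise N T \<sigma>\<^sub>\<eta> \<sigma>\<^sub>\<epsilon>)"
proof -
  let ?c = "\<lambda>s. compose (noise_index N T) (\<lambda>z. s * z)"
  have "?c s (?c (1 / s) \<omega>) = \<omega>" if "\<omega> \<in> space (noise N T (s * \<sigma>\<^sub>\<eta>) (s * \<sigma>\<^sub>\<epsilon>))" for \<omega>
  proof
    fix k show "?c s (?c (1 / s) \<omega>) k = \<omega> k"
    proof (cases "k \<in> noise_index N T")
      \<comment> \<open>Off the index set, points of the product space are \<open>undefined\<close>,
        so scaling back and forth returns exactly the same function.\<close>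
      case False
      then have "\<omega> k = undefined"
        using that unfolding noise_def space_PiM by (rule PiE_arb[rotated])
      with False show ?thesis by (simp add: compose_def)
    qed (use \<open>s > 0\<close> in \<open>simp add: compose_def\<close>)
  qed
  then have "integral\<^sup>L (distr (noise N T \<sigma>\<^sub>\<eta> \<sigma>\<^sub>\<epsilon>) (noise N T (s * \<sigma>\<^sub>\<eta>) (s * \<sigma>\<^sub>\<epsilon>)) (?c s)) F =
      (\<integral>\<omega>. F (?c s \<omega>) \<partial>noise N T \<sigma>\<^sub>\<eta> \<sigma>\<^sub>\<epsilon>)"
    by (rule integral_distr_iso[OF measurable_noise_scale measurable_noise_scale])
  then show ?thesis
    by (simp add: distr_noise_scale assms)
qed

section \<open>Scaled expected length\<close>

lemma scaled_expected_length_standardize: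
  assumes SSB: "SSB N T x > 0" and SSW: "SSW N T x > 0" and pos: "\<sigma>\<^sub>\<eta> > 0" "\<sigma>\<^sub>\<epsilon> > 0"
  shows "scaled_expected_length N T x \<alpha>\<^sub>H \<alpha> \<beta> a b \<xi> \<sigma>\<^sub>\<eta> \<sigma>\<^sub>\<epsilon> =
    scaled_expected_length N T x \<alpha>\<^sub>H \<alpha> \<beta> 0 0 (\<xi> / \<sigma>\<^sub>\<epsilon>) (\<sigma>\<^sub>\<eta> / \<sigma>\<^sub>\<epsilon>) 1"
proof -
  let ?c = "compose (noise_index N T) (\<lambda>z. \<sigma>\<^sub>\<epsilon> * z)"
  have panel: "affine_panel N T x (response T x a b \<xi> (?c \<omega>))
      (response T x 0 0 (\<xi> / \<sigma>\<^sub>\<epsilon>) \<omega>) a b \<sigma>\<^sub>\<epsilon>" for \<omega>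
    using assms by unfold_locales (auto simp: response_def compose_def algebra_simps)
  have "integral\<^sup>L (noise N T \<sigma>\<^sub>\<eta> \<sigma>\<^sub>\<epsilon>) F = (\<integral>\<omega>. F (?c \<omega>) \<partial>noise N T (\<sigma>\<^sub>\<eta> / \<sigma>\<^sub>\<epsilon>) 1)"
    for F :: "(nat + nat \<times> nat \<Rightarrow> real) \<Rightarrow> real"
    using integral_noise_scale[of "\<sigma>\<^sub>\<eta> / \<sigma>\<^sub>\<epsilon>" 1 \<sigma>\<^sub>\<epsilon> N T F] pos by simp
  then show ?thesis
    using pos
    \<comment> \<open>A constant factor leaves the integral even for nonintegrable functions, so the
      nonzero \<open>\<sigma>\<^sub>\<epsilon>\<close> cancels without any integrability
      argument.\<close>
    by (simp add: scaled_expected_length_def affine_panel.measure_K_hat_affine[OF panel]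
        affine_panel.measure_J_star_hat_affine[OF panel])
qed

theorem theorem5:
  fixes N T :: nat and x :: "nat \<Rightarrow> nat \<Rightarrow> real" and \<alpha>\<^sub>H \<alpha> \<beta> :: real
  assumes "SSB N T x > 0" and "SSW N T x > 0"
    and "0 < \<alpha>\<^sub>H" and "\<alpha>\<^sub>H < 1"
    and "0 < \<alpha>" and "\<alpha> < 1"
    and "0 < \<beta>" and "\<beta> < 1"
  shows "\<exists>L :: real \<Rightarrow> real \<Rightarrow> real.
    \<forall>a b \<xi> \<sigma>\<^sub>\<eta> \<sigma>\<^sub>\<epsilon> :: real. \<sigma>\<^sub>\<eta> > 0 \<and> \<sigma>\<^sub>\<epsilon> > 0 \<longrightarrow>
      scaled_expected_length N T x \<alpha>\<^sub>H \<alpha> \<beta> a b \<xi> \<sigma>\<^sub>\<eta> \<sigma>\<^sub>\<epsilon>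
        = L (\<sigma>\<^sub>\<eta>\<^sup>2 / \<sigma>\<^sub>\<epsilon>\<^sup>2) (\<xi> * sqrt (real N) / \<sigma>\<^sub>\<epsilon>)"
proof (intro exI allI impI)
  fix a b \<xi> \<sigma>\<^sub>\<eta> \<sigma>\<^sub>\<epsilon> :: real
  assume pos: "\<sigma>\<^sub>\<eta> > 0 \<and> \<sigma>\<^sub>\<epsilon> > 0"
  have "N > 0"
    using \<open>SSB N T x > 0\<close> by (cases N) (auto simp: SSB_def)
  \<comment> \<open>The witness inverts the parametrization: \<open>\<gamma> / sqrt (real N)\<close>
    gives back \<open>\<xi> / \<sigma>\<^sub>\<epsilon>\<close> because \<open>N > 0\<close>, and
    \<open>sqrt \<nu>\<close> gives back
    \<open>\<sigma>\<^sub>\<eta> / \<sigma>\<^sub>\<epsilon>\<close> by positivity.\<close>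
  then show "scaled_expected_length N T x \<alpha>\<^sub>H \<alpha> \<beta> a b \<xi> \<sigma>\<^sub>\<eta> \<sigma>\<^sub>\<epsilon> =
      (\<lambda>\<nu> \<gamma>. scaled_expected_length N T x \<alpha>\<^sub>H \<alpha> \<beta> 0 0 (\<gamma> / sqrt (real N)) (sqrt \<nu>) 1)
        (\<sigma>\<^sub>\<eta>\<^sup>2 / \<sigma>\<^sub>\<epsilon>\<^sup>2) (\<xi> * sqrt (real N) / \<sigma>\<^sub>\<epsilon>)"
    using assms pos scaled_expected_length_standardize[of N T x \<sigma>\<^sub>\<eta> \<sigma>\<^sub>\<epsilon>]
    by (simp add: real_sqrt_divide)
qed

end
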